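(* If there exists a periodic non-sofic group without involutions, then there exists a divisible periodic non-sofic group.
   Context: For $n\ge 1$, the normalized Hamming metric on the symmetric group $S_n$ is $d_{\mathrm{hamm}}(\sigma,\tau)=\frac1n\#\{i:\sigma(i)\ne\tau(i)\}$. A group $G$ is sofic if there exist a set $A$, an ultrafilter $\mathcal U$ on $A$ and a map $\alpha\mapsto n(\alpha)$ from $A$ to the positive integers such that $G$ is isomorphic to a subgroup of the metric ultraproduct $\prod_{\alpha\in A}(S_{n(\alpha)},d_{\mathrm{hamm}})/\mathcal U$, i.e. the quotient of $\prod_{\alpha} S_{n(\alpha)}$ by the normal subgroup of all $(\sigma_\alpha)$ with $\lim_{\alpha\to\mathcal U} d_{\mathrm{hamm}}(\sigma_\alpha,\mathrm{Id})=0$. A group is periodic (torsion) if every element has finite order; an involution is an element of order $2$. A (not necessarily abelian) group $D$ is divisible if for every $g\in D$ and every integer $n\ge 1$ there is $x\in D$ with $x^n=g$. *)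

theory Defs
  imports
    Complex_Main
    "HOL-Algebra.Multiplicative_Group"
    "HOL-Algebra.Product_Groups"
    "HOL-Algebra.Sym_Groups"
begin

definition periodic_group :: "('a, 'b) monoid_scheme \<Rightarrow> bool" where
  "periodic_group G \<longleftrightarrow> group G \<and> (\<forall>g\<in>carrier G. \<exists>n::nat. n \<ge> 1 \<and> g [^]\<^bsub>G\<^esub> n = \<one>\<^bsub>G\<^esub>)"

definition involution :: "('a, 'b) monoid_scheme \<Rightarrow> 'a \<Rightarrow> bool" where
  "involution G g \<longleftrightarrow> g \<in> carrier G \<and> group.ord G g = 2"

definition divisible_group :: "('a, 'b) monoid_scheme \<Rightarrow> bool" where
  "divisible_group G \<longleftrightarrow>
     group G \<and> (\<forall>g\<in>carrier G. \<forall>n::nat. n \<ge> 1 \<longrightarrow> (\<exists>x\<in>carrier G. x [^]\<^bsub>G\<^esub> n = g))"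

definition hamming_dist :: "nat \<Rightarrow> (nat \<Rightarrow> nat) \<Rightarrow> (nat \<Rightarrow> nat) \<Rightarrow> real" where
  "hamming_dist n \<sigma> \<tau> = real (card {i \<in> {1..n}. \<sigma> i \<noteq> \<tau> i}) / real n"

text \<open>Filters live on whole types; an ultrafilter on the set \<open>A\<close> is an ultrafilter
  on the type that contains \<open>A\<close>.\<close>

definition ultrafilter_on :: "'i set \<Rightarrow> 'i filter \<Rightarrow> bool" where
  "ultrafilter_on A U \<longleftrightarrow>
     U \<noteq> bot \<and> U \<le> principal A \<and>
     (\<forall>P. eventually P U \<or> eventually (\<lambda>x. \<not> P x) U)"

definition sym_product :: "'i set \<Rightarrow> ('i \<Rightarrow> nat) \<Rightarrow> ('i \<Rightarrow> nat \<Rightarrow> nat) monoid" where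
  "sym_product A n = product_group A (\<lambda>\<alpha>. sym_group (n \<alpha>))"

definition hamming_null :: "'i set \<Rightarrow> 'i filter \<Rightarrow> ('i \<Rightarrow> nat) \<Rightarrow> ('i \<Rightarrow> nat \<Rightarrow> nat) set" where
  "hamming_null A U n =
     {\<sigma> \<in> carrier (sym_product A n). ((\<lambda>\<alpha>. hamming_dist (n \<alpha>) (\<sigma> \<alpha>) id) \<longlongrightarrow> 0) U}"

definition metric_ultraproduct ::
    "'i set \<Rightarrow> 'i filter \<Rightarrow> ('i \<Rightarrow> nat) \<Rightarrow> ('i \<Rightarrow> nat \<Rightarrow> nat) set monoid" where
  "metric_ultraproduct A U n = sym_product A n Mod hamming_null A U n"

definition sofic_wrt ::
    "('a, 'b) monoid_scheme \<Rightarrow> 'i set \<Rightarrow> 'i filter \<Rightarrow> ('i \<Rightarrow> nat) \<Rightarrow> bool" where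
  "sofic_wrt G A U n \<longleftrightarrow>
     group G \<and> ultrafilter_on A U \<and> (\<forall>\<alpha>\<in>A. n \<alpha> \<ge> 1) \<and>
     (\<exists>H. subgroup H (metric_ultraproduct A U n) \<and>
          G \<cong> (metric_ultraproduct A U n)\<lparr>carrier := H\<rparr>)"

text \<open>HOL cannot quantify over the type of the index set. Index sets of type
  \<open>('a set \<times> nat) set\<close> suffice for a group with elements in \<open>'a\<close>: theorem
  \<open>sofic_if_sofic_wrt\<close> below shows that an embedding over an index set of any other type
  yields one over such a set, so no soficity is lost.\<close>

definition sofic :: "('a, 'b) monoid_scheme \<Rightarrow> bool" where
  "sofic G \<longleftrightarrow> (\<exists>(A :: ('a set \<times> nat) set) U n. sofic_wrt G A U n)"


section \<open>The null sequences form a normal subgroup\<close>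

lemma hamming_dist_nonneg: "0 \<le> hamming_dist n \<sigma> \<tau>"
  by (simp add: hamming_dist_def)

lemma hamming_dist_refl [simp]: "hamming_dist n \<sigma> \<sigma> = 0"
  by (simp add: hamming_dist_def)

lemma hamming_dist_sym: "hamming_dist n \<sigma> \<tau> = hamming_dist n \<tau> \<sigma>"
proof -
  have "{i \<in> {1..n}. \<sigma> i \<noteq> \<tau> i} = {i \<in> {1..n}. \<tau> i \<noteq> \<sigma> i}" by auto
  then show ?thesis by (simp only: hamming_dist_def)
qed

lemma hamming_dist_triangle:
  "hamming_dist n \<sigma> \<rho> \<le> hamming_dist n \<sigma> \<tau> + hamming_dist n \<tau> \<rho>"
proof -
  have "card {i \<in> {1..n}. \<sigma> i \<noteq> \<rho> i}
      \<le> card ({i \<in> {1..n}. \<sigma> i \<noteq> \<tau> i} \<union> {i \<in> {1..n}. \<tau> i \<noteq> \<rho> i})"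
    by (rule card_mono) auto
  also have "\<dots> \<le> card {i \<in> {1..n}. \<sigma> i \<noteq> \<tau> i} + card {i \<in> {1..n}. \<tau> i \<noteq> \<rho> i}"
    by (rule card_Un_le)
  finally have "real (card {i \<in> {1..n}. \<sigma> i \<noteq> \<rho> i})
      \<le> real (card {i \<in> {1..n}. \<sigma> i \<noteq> \<tau> i}) + real (card {i \<in> {1..n}. \<tau> i \<noteq> \<rho> i})"
    by linarith
  then show ?thesis
    by (simp add: hamming_dist_def divide_right_mono flip: add_divide_distrib)
qed

lemma hamming_dist_left:
  assumes "\<rho> permutes {1..n}"
  shows "hamming_dist n (\<rho> \<circ> \<sigma>) (\<rho> \<circ> \<tau>) = hamming_dist n \<sigma> \<tau>"
proof -
  have "inj \<rho>" using assms by (rule permutes_inj)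
  then show ?thesis by (simp add: hamming_dist_def inj_eq)
qed

lemma hamming_dist_right:
  assumes "\<rho> permutes {1..n}"
  shows "hamming_dist n (\<sigma> \<circ> \<rho>) (\<tau> \<circ> \<rho>) = hamming_dist n \<sigma> \<tau>"
proof -
  have img: "\<rho> ` {i \<in> {1..n}. \<sigma> (\<rho> i) \<noteq> \<tau> (\<rho> i)} = {i \<in> {1..n}. \<sigma> i \<noteq> \<tau> i}"
  proof (rule Set.set_eqI, rule iffI)
    fix j assume "j \<in> \<rho> ` {i \<in> {1..n}. \<sigma> (\<rho> i) \<noteq> \<tau> (\<rho> i)}"
    then show "j \<in> {i \<in> {1..n}. \<sigma> i \<noteq> \<tau> i}"
      using permutes_in_image [OF assms] by auto
  next
    fix j assume j: "j \<in> {i \<in> {1..n}. \<sigma> i \<noteq> \<tau> i}"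
    then have "j \<in> \<rho> ` {1..n}" using permutes_image [OF assms] by simp
    then obtain i where "i \<in> {1..n}" "j = \<rho> i" by (rule imageE)
    then show "j \<in> \<rho> ` {i \<in> {1..n}. \<sigma> (\<rho> i) \<noteq> \<tau> (\<rho> i)}" using j by simp
  qed
  have "inj_on \<rho> {i \<in> {1..n}. \<sigma> (\<rho> i) \<noteq> \<tau> (\<rho> i)}"
    using permutes_inj [OF assms] by (rule inj_on_subset) simp
  from card_image [OF this]
  have "card {i \<in> {1..n}. \<sigma> (\<rho> i) \<noteq> \<tau> (\<rho> i)} = card {i \<in> {1..n}. \<sigma> i \<noteq> \<tau> i}"
    unfolding img by (rule sym)
  then show ?thesis by (simp add: hamming_dist_def)
qed

lemma group_sym_product: "group (sym_product A n)"
  by (simp add: sym_product_def sym_group_is_group)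

lemma sym_product_carrier_D:
  "\<sigma> \<in> carrier (sym_product A n) \<Longrightarrow> \<alpha> \<in> A \<Longrightarrow> \<sigma> \<alpha> permutes {1..n \<alpha>}"
  by (simp add: sym_product_def sym_group_def PiE_iff)

lemma sym_product_mult:
  "\<alpha> \<in> A \<Longrightarrow> (\<sigma> \<otimes>\<^bsub>sym_product A n\<^esub> \<tau>) \<alpha> = \<sigma> \<alpha> \<circ> \<tau> \<alpha>"
  by (simp add: sym_product_def sym_group_def)

lemma sym_product_one: "\<alpha> \<in> A \<Longrightarrow> \<one>\<^bsub>sym_product A n\<^esub> \<alpha> = id"
  by (simp add: sym_product_def sym_group_def)

lemma sym_product_mult_inv:
  assumes "\<sigma> \<in> carrier (sym_product A n)" "\<alpha> \<in> A"
  shows "\<sigma> \<alpha> \<circ> (inv\<^bsub>sym_product A n\<^esub> \<sigma>) \<alpha> = id"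
  using fun_cong [OF group.r_inv [OF group_sym_product assms(1)], of \<alpha>] assms(2)
  by (simp add: sym_product_mult sym_product_one)

lemma hamming_sym_product_mult_inv:
  assumes "\<sigma> \<in> carrier (sym_product A n)" "\<tau> \<in> carrier (sym_product A n)" "\<alpha> \<in> A"
  shows "hamming_dist (n \<alpha>) ((\<sigma> \<otimes>\<^bsub>sym_product A n\<^esub> inv\<^bsub>sym_product A n\<^esub> \<tau>) \<alpha>) id
       = hamming_dist (n \<alpha>) (\<sigma> \<alpha>) (\<tau> \<alpha>)"
proof -
  interpret P: group "sym_product A n" by (rule group_sym_product)
  let ?t = "(inv\<^bsub>sym_product A n\<^esub> \<tau>) \<alpha>"
  have "?t permutes {1..n \<alpha>}" using assms by (blast intro: sym_product_carrier_D P.inv_closed)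
  then have "hamming_dist (n \<alpha>) (\<sigma> \<alpha> \<circ> ?t) (\<tau> \<alpha> \<circ> ?t) = hamming_dist (n \<alpha>) (\<sigma> \<alpha>) (\<tau> \<alpha>)"
    by (rule hamming_dist_right)
  then show ?thesis using assms by (simp add: sym_product_mult sym_product_mult_inv)
qed

lemma eventually_in_ultrafilter_set:
  assumes "ultrafilter_on A U"
  shows "eventually (\<lambda>\<alpha>. \<alpha> \<in> A) U"
  using assms by (simp add: ultrafilter_on_def le_principal)

lemma mult_inv_in_hamming_null_iff:
  assumes U: "ultrafilter_on A U"
    and \<sigma>: "\<sigma> \<in> carrier (sym_product A n)" and \<tau>: "\<tau> \<in> carrier (sym_product A n)"
  shows "\<sigma> \<otimes>\<^bsub>sym_product A n\<^esub> inv\<^bsub>sym_product A n\<^esub> \<tau> \<in> hamming_null A U n \<longleftrightarrow>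
         ((\<lambda>\<alpha>. hamming_dist (n \<alpha>) (\<sigma> \<alpha>) (\<tau> \<alpha>)) \<longlongrightarrow> 0) U"
proof -
  interpret P: group "sym_product A n" by (rule group_sym_product)
  have "eventually (\<lambda>\<alpha>. hamming_dist (n \<alpha>)
            ((\<sigma> \<otimes>\<^bsub>sym_product A n\<^esub> inv\<^bsub>sym_product A n\<^esub> \<tau>) \<alpha>) id
          = hamming_dist (n \<alpha>) (\<sigma> \<alpha>) (\<tau> \<alpha>)) U"
    using eventually_in_ultrafilter_set [OF U]
    by eventually_elim (rule hamming_sym_product_mult_inv [OF \<sigma> \<tau>])
  then show ?thesis using \<sigma> \<tau> by (simp add: hamming_null_def tendsto_cong)
qed

lemma hamming_null_normal:
  assumes U: "ultrafilter_on A U"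
  shows "hamming_null A U n \<lhd> sym_product A n"
proof -
  let ?P = "sym_product A n" and ?N = "hamming_null A U n"
  interpret P: group ?P by (rule group_sym_product)
  note inA = eventually_in_ultrafilter_set [OF U]
  have one: "\<one>\<^bsub>?P\<^esub> \<in> ?N"
    using mult_inv_in_hamming_null_iff [OF U P.one_closed P.one_closed] by simp
  have sub: "subgroup ?N ?P"
  proof (rule P.subgroupI)
    show "?N \<subseteq> carrier ?P" by (auto simp: hamming_null_def)
    show "?N \<noteq> {}" using one by blast
  next
    fix a assume a: "a \<in> ?N"
    then have ac: "a \<in> carrier ?P"
      and l: "((\<lambda>\<alpha>. hamming_dist (n \<alpha>) (a \<alpha>) id) \<longlongrightarrow> 0) U"
      by (auto simp: hamming_null_def)
    have "eventually (\<lambda>\<alpha>. hamming_dist (n \<alpha>) (a \<alpha>) id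
        = hamming_dist (n \<alpha>) (\<one>\<^bsub>?P\<^esub> \<alpha>) (a \<alpha>)) U"
      using inA by eventually_elim (simp add: sym_product_one hamming_dist_sym)
    then have "((\<lambda>\<alpha>. hamming_dist (n \<alpha>) (\<one>\<^bsub>?P\<^esub> \<alpha>) (a \<alpha>)) \<longlongrightarrow> 0) U"
      using l by (simp add: tendsto_cong)
    then show "inv\<^bsub>?P\<^esub> a \<in> ?N"
      using mult_inv_in_hamming_null_iff [OF U P.one_closed ac] ac by simp
  next
    fix a b assume "a \<in> ?N" "b \<in> ?N"
    then have ac: "a \<in> carrier ?P" and bc: "b \<in> carrier ?P"
      and la: "((\<lambda>\<alpha>. hamming_dist (n \<alpha>) (a \<alpha>) id) \<longlongrightarrow> 0) U"
      and lb: "((\<lambda>\<alpha>. hamming_dist (n \<alpha>) (b \<alpha>) id) \<longlongrightarrow> 0) U"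
      by (auto simp: hamming_null_def)
    have "((\<lambda>\<alpha>. hamming_dist (n \<alpha>) ((a \<otimes>\<^bsub>?P\<^esub> b) \<alpha>) id) \<longlongrightarrow> 0) U"
    proof (rule tendsto_sandwich [OF _ _ tendsto_const])
      show "\<forall>\<^sub>F \<alpha> in U. 0 \<le> hamming_dist (n \<alpha>) ((a \<otimes>\<^bsub>?P\<^esub> b) \<alpha>) id"
        by (simp add: hamming_dist_nonneg)
      show "\<forall>\<^sub>F \<alpha> in U. hamming_dist (n \<alpha>) ((a \<otimes>\<^bsub>?P\<^esub> b) \<alpha>) id
              \<le> hamming_dist (n \<alpha>) (b \<alpha>) id + hamming_dist (n \<alpha>) (a \<alpha>) id"
        using inA
      proof eventually_elim
        case (elim \<alpha>)
        then have "hamming_dist (n \<alpha>) (a \<alpha> \<circ> b \<alpha>) (a \<alpha> \<circ> id) = hamming_dist (n \<alpha>) (b \<alpha>) id"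
          using ac by (intro hamming_dist_left) (rule sym_product_carrier_D)
        then show ?case
          using hamming_dist_triangle [of "n \<alpha>" "a \<alpha> \<circ> b \<alpha>" id "a \<alpha>"] elim
          by (simp add: sym_product_mult)
      qed
      show "((\<lambda>\<alpha>. hamming_dist (n \<alpha>) (b \<alpha>) id + hamming_dist (n \<alpha>) (a \<alpha>) id) \<longlongrightarrow> 0) U"
        using tendsto_add [OF lb la] by simp
    qed
    then show "a \<otimes>\<^bsub>?P\<^esub> b \<in> ?N" using ac bc by (simp add: hamming_null_def)
  qed
  show ?thesis
  proof (rule P.normal_invI [OF sub])
    fix x h assume xc: "x \<in> carrier ?P" and h: "h \<in> ?N"
    then have hc: "h \<in> carrier ?P"
      and l: "((\<lambda>\<alpha>. hamming_dist (n \<alpha>) (h \<alpha>) id) \<longlongrightarrow> 0) U"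
      by (auto simp: hamming_null_def)
    have "eventually (\<lambda>\<alpha>. hamming_dist (n \<alpha>) (h \<alpha>) id
        = hamming_dist (n \<alpha>) ((x \<otimes>\<^bsub>?P\<^esub> h) \<alpha>) (x \<alpha>)) U"
      using inA
    proof eventually_elim
      case (elim \<alpha>)
      then have "hamming_dist (n \<alpha>) (x \<alpha> \<circ> h \<alpha>) (x \<alpha> \<circ> id) = hamming_dist (n \<alpha>) (h \<alpha>) id"
        using xc by (intro hamming_dist_left) (rule sym_product_carrier_D)
      then show ?case using elim by (simp add: sym_product_mult)
    qed
    then have "((\<lambda>\<alpha>. hamming_dist (n \<alpha>) ((x \<otimes>\<^bsub>?P\<^esub> h) \<alpha>) (x \<alpha>)) \<longlongrightarrow> 0) U"
      using l by (simp add: tendsto_cong)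
    then show "x \<otimes>\<^bsub>?P\<^esub> h \<otimes>\<^bsub>?P\<^esub> inv\<^bsub>?P\<^esub> x \<in> ?N"
      using mult_inv_in_hamming_null_iff [OF U P.m_closed [OF xc hc] xc] by simp
  qed
qed

lemma group_metric_ultraproduct:
  "ultrafilter_on A U \<Longrightarrow> group (metric_ultraproduct A U n)"
  unfolding metric_ultraproduct_def
  by (rule normal.factorgroup_is_group) (rule hamming_null_normal)

lemma hamming_null_rcos_eq_iff:
  assumes U: "ultrafilter_on A U"
    and \<sigma>: "\<sigma> \<in> carrier (sym_product A n)" and \<tau>: "\<tau> \<in> carrier (sym_product A n)"
  shows "hamming_null A U n #>\<^bsub>sym_product A n\<^esub> \<sigma> = hamming_null A U n #>\<^bsub>sym_product A n\<^esub> \<tau> \<longleftrightarrow>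
         ((\<lambda>\<alpha>. hamming_dist (n \<alpha>) (\<sigma> \<alpha>) (\<tau> \<alpha>)) \<longlongrightarrow> 0) U"
proof -
  let ?P = "sym_product A n" and ?N = "hamming_null A U n"
  interpret N: normal ?N ?P by (rule hamming_null_normal [OF U])
  have sub: "subgroup ?N ?P" by (rule N.subgroup_axioms)
  have "?N #>\<^bsub>?P\<^esub> \<sigma> = ?N #>\<^bsub>?P\<^esub> \<tau> \<longleftrightarrow> \<sigma> \<in> ?N #>\<^bsub>?P\<^esub> \<tau>"
    using N.rcos_self [OF \<sigma> sub] N.repr_independence [OF _ \<tau> sub] by auto
  also have "\<dots> \<longleftrightarrow> \<sigma> \<otimes>\<^bsub>?P\<^esub> inv\<^bsub>?P\<^esub> \<tau> \<in> ?N"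
    using N.rcos_module [OF N.is_group \<tau> \<sigma>] by simp
  finally show ?thesis using mult_inv_in_hamming_null_iff [OF U \<sigma> \<tau>] by simp
qed


section \<open>Independence of the index type\<close>

lemma ex_ultrafilter_le:
  fixes F :: "'i filter"
  assumes "F \<noteq> bot" "F \<le> principal A"
  shows "\<exists>U. U \<le> F \<and> ultrafilter_on A U"
proof -
  define S where "S = {V. V \<noteq> bot \<and> V \<le> F}"
  have "\<exists>M\<in>S. \<forall>V\<in>S. V \<le> M \<longrightarrow> V = M"
  proof -
    have "\<exists>M\<in>S. \<forall>V\<in>S. M \<ge> V \<longrightarrow> V = M"
    proof (rule predicate_Zorn [OF partial_order_on_relation_ofI])
      fix C assume C: "C \<in> Chains (relation_of (\<lambda>x y. y \<le> x) S)"
      then have CS: "C \<subseteq> S" and tot: "\<And>x y. x \<in> C \<Longrightarrow> y \<in> C \<Longrightarrow> x \<le> y \<or> y \<le> x"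
        by (auto simp: Chains_def relation_of_def)
      show "\<exists>u\<in>S. \<forall>a\<in>C. u \<le> a"
      proof (cases "C = {}")
        case True
        then show ?thesis using assms by (auto simp: S_def)
      next
        case False
        have "Inf C \<noteq> bot"
        proof
          assume "Inf C = bot"
          then have "eventually (\<lambda>_. False) (Inf C)" by simp
          then have "\<exists>b\<in>C. eventually (\<lambda>_. False) b"
            using False tot
            by (subst (asm) eventually_Inf_base) (auto intro: exI)
          then show False using CS by (auto simp: S_def trivial_limit_def)
        qed
        moreover have "Inf C \<le> F"
          using False CS by (auto simp: S_def intro: Inf_lower2)
        ultimately show ?thesis by (auto simp: S_def intro: Inf_lower)
      qed
    qed auto
    then show ?thesis by blast
  qed
  then obtain M where M: "M \<in> S" and max: "\<And>V. V \<in> S \<Longrightarrow> V \<le> M \<Longrightarrow> V = M" by blast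
  have "eventually P M \<or> eventually (\<lambda>x. \<not> P x) M" for P
  proof (cases "inf M (principal {x. P x}) = bot")
    case True
    then have "eventually (\<lambda>_. False) (inf M (principal {x. P x}))" by simp
    then show ?thesis by (simp add: eventually_inf_principal)
  next
    case False
    then have "inf M (principal {x. P x}) = M"
      using M by (intro max) (auto simp: S_def intro: le_infI1)
    then have "M \<le> principal {x. P x}" by (metis inf.cobounded2)
    then show ?thesis by (simp add: le_principal)
  qed
  then have "ultrafilter_on A M" using M assms by (auto simp: S_def ultrafilter_on_def)
  then show ?thesis using M by (auto simp: S_def)
qed

theorem sofic_if_sofic_wrt:
  fixes G :: "('a, 'b) monoid_scheme" and A :: "'i set"
  assumes "sofic_wrt G A U n"
  shows "sofic G"
proof -
  let ?P = "sym_product A n" and ?N = "hamming_null A U n"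
  let ?d = "\<lambda>\<alpha>. hamming_dist (n \<alpha>)"
  from assms have gG: "group G" and U: "ultrafilter_on A U" and n1: "\<And>\<alpha>. \<alpha> \<in> A \<Longrightarrow> n \<alpha> \<ge> 1"
    by (auto simp: sofic_wrt_def)
  interpret G: group G by (rule gG)
  interpret N: normal ?N ?P by (rule hamming_null_normal [OF U])
  from assms obtain H h where H: "subgroup H (?P Mod ?N)"
    and h: "h \<in> iso G ((?P Mod ?N)\<lparr>carrier := H\<rparr>)"
    by (auto simp: sofic_wrt_def metric_ultraproduct_def is_iso_def)
  have hc: "h g \<in> carrier (?P Mod ?N)" if "g \<in> carrier G" for g
    using h that subgroup.subset [OF H] by (auto simp: iso_def hom_def)
  have hm: "h (g \<otimes>\<^bsub>G\<^esub> g') = h g <#>\<^bsub>?P\<^esub> h g'" if "g \<in> carrier G" "g' \<in> carrier G" for g g'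
    using h that by (auto simp: iso_def hom_def)
  have hinj: "inj_on h (carrier G)"
    using h by (auto simp: iso_def bij_betw_def)
  have "\<exists>r. \<forall>g\<in>carrier G. r g \<in> carrier ?P \<and> h g = ?N #>\<^bsub>?P\<^esub> r g"
    using hc by (intro bchoice) (auto simp: carrier_FactGroup)
  then obtain r where rc: "\<And>g. g \<in> carrier G \<Longrightarrow> r g \<in> carrier ?P"
    and hr: "\<And>g. g \<in> carrier G \<Longrightarrow> h g = ?N #>\<^bsub>?P\<^esub> r g" by blast
  have lim: "((\<lambda>\<alpha>. ?d \<alpha> (r (g \<otimes>\<^bsub>G\<^esub> g') \<alpha>) ((r g \<otimes>\<^bsub>?P\<^esub> r g') \<alpha>)) \<longlongrightarrow> 0) U"
    if "g \<in> carrier G" "g' \<in> carrier G" for g g'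
    using that hm [OF that]
    by (simp add: hr rc N.rcos_sum hamming_null_rcos_eq_iff [OF U])
  have "\<exists>\<delta>>0. eventually (\<lambda>\<alpha>. \<delta> \<le> ?d \<alpha> (r g \<alpha>) (r g' \<alpha>)) U"
    if "g \<in> carrier G" "g' \<in> carrier G" "g \<noteq> g'" for g g'
  proof (rule ccontr)
    assume neg: "\<not> ?thesis"
    have "((\<lambda>\<alpha>. ?d \<alpha> (r g \<alpha>) (r g' \<alpha>)) \<longlongrightarrow> 0) U"
    proof (rule tendstoI)
      fix e :: real assume "e > 0"
      then have "\<not> eventually (\<lambda>\<alpha>. e \<le> ?d \<alpha> (r g \<alpha>) (r g' \<alpha>)) U" using neg by blast
      then have "eventually (\<lambda>\<alpha>. \<not> e \<le> ?d \<alpha> (r g \<alpha>) (r g' \<alpha>)) U"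
        using U by (auto simp: ultrafilter_on_def)
      then show "eventually (\<lambda>\<alpha>. dist (?d \<alpha> (r g \<alpha>) (r g' \<alpha>)) 0 < e) U"
        by eventually_elim (simp add: hamming_dist_nonneg)
    qed
    then have "h g = h g'"
      using that by (simp add: hr rc hamming_null_rcos_eq_iff [OF U])
    then show False using that hinj by (auto simp: inj_on_def)
  qed
  then obtain \<delta> where \<delta>0: "\<And>g g'. g \<in> carrier G \<Longrightarrow> g' \<in> carrier G \<Longrightarrow> g \<noteq> g' \<Longrightarrow> \<delta> g g' > 0"
    and \<delta>: "\<And>g g'. g \<in> carrier G \<Longrightarrow> g' \<in> carrier G \<Longrightarrow> g \<noteq> g' \<Longrightarrow>
              eventually (\<lambda>\<alpha>. \<delta> g g' \<le> ?d \<alpha> (r g \<alpha>) (r g' \<alpha>)) U"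
    by metis
  define J :: "('a set \<times> nat) set" where "J = {(S, k). finite S \<and> S \<subseteq> carrier G}"
  define good where "good = (\<lambda>(S, k::nat) \<alpha>. \<alpha> \<in> A \<and>
    (\<forall>g\<in>S. \<forall>g'\<in>S. ?d \<alpha> (r (g \<otimes>\<^bsub>G\<^esub> g') \<alpha>) (r g \<alpha> \<circ> r g' \<alpha>) < inverse (real (Suc k)) \<and>
       (g \<noteq> g' \<longrightarrow> \<delta> g g' \<le> ?d \<alpha> (r g \<alpha>) (r g' \<alpha>))))"
  have "\<exists>\<alpha>. good j \<alpha>" if "j \<in> J" for j
  proof -
    obtain S k where j: "j = (S, k)" by (cases j)
    with that have fin: "finite S" and S: "S \<subseteq> carrier G" by (auto simp: J_def)
    have "eventually (\<lambda>\<alpha>. \<alpha> \<in> A \<and> (\<forall>g\<in>S. \<forall>g'\<in>S.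
        ?d \<alpha> (r (g \<otimes>\<^bsub>G\<^esub> g') \<alpha>) (r g \<alpha> \<circ> r g' \<alpha>) < inverse (real (Suc k)) \<and>
       (g \<noteq> g' \<longrightarrow> \<delta> g g' \<le> ?d \<alpha> (r g \<alpha>) (r g' \<alpha>)))) U"
    proof (intro eventually_conj eventually_ball_finite ballI fin eventually_in_ultrafilter_set [OF U])
      fix g g' assume "g \<in> S" "g' \<in> S"
      then have gc: "g \<in> carrier G" "g' \<in> carrier G" using S by auto
      have "eventually (\<lambda>\<alpha>. dist (?d \<alpha> (r (g \<otimes>\<^bsub>G\<^esub> g') \<alpha>) ((r g \<otimes>\<^bsub>?P\<^esub> r g') \<alpha>)) 0
              < inverse (real (Suc k))) U"
        using lim [OF gc] by (rule tendstoD) simp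
      then show "eventually (\<lambda>\<alpha>. ?d \<alpha> (r (g \<otimes>\<^bsub>G\<^esub> g') \<alpha>) (r g \<alpha> \<circ> r g' \<alpha>)
              < inverse (real (Suc k))) U"
        using eventually_in_ultrafilter_set [OF U]
        by eventually_elim (simp add: hamming_dist_nonneg sym_product_mult)
      show "eventually (\<lambda>\<alpha>. g \<noteq> g' \<longrightarrow> \<delta> g g' \<le> ?d \<alpha> (r g \<alpha>) (r g' \<alpha>)) U"
        using \<delta> [OF gc] by (cases "g = g'") auto
    qed
    then have "eventually (good j) U" by (simp add: good_def j)
    then show ?thesis using U by (auto simp: ultrafilter_on_def dest: eventually_happens')
  qed
  then obtain a where a: "\<And>j. j \<in> J \<Longrightarrow> good j (a j)" by metis
  then have aA: "\<And>j. j \<in> J \<Longrightarrow> a j \<in> A" by (auto simp: good_def split: prod.splits)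

  define F where "F = finite_subsets_at_top (carrier G) \<times>\<^sub>F (sequentially :: nat filter)"
  have evF: "eventually (\<lambda>j. j \<in> J \<and> T \<subseteq> fst j \<and> k \<le> snd j) F"
    if "finite T" "T \<subseteq> carrier G" for T k
    unfolding F_def eventually_prod_filter
    using that
    by (intro exI [of _ "\<lambda>S. finite S \<and> T \<subseteq> S \<and> S \<subseteq> carrier G"] exI [of _ "\<lambda>m. k \<le> m"])
       (auto simp: J_def eventually_finite_subsets_at_top eventually_sequentially)
  have "F \<noteq> bot" by (simp add: F_def prod_filter_eq_bot finite_subsets_at_top_neq_bot)
  moreover have "F \<le> principal J"
    using evF [of "{}" 0] by (auto simp: le_principal elim: eventually_mono)
  ultimately obtain V where VF: "V \<le> F" and V: "ultrafilter_on J V"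
    using ex_ultrafilter_le by blast
  have evV: "eventually (\<lambda>j. j \<in> J \<and> T \<subseteq> fst j \<and> k \<le> snd j) V"
    if "finite T" "T \<subseteq> carrier G" for T k
    using filter_leD [OF VF evF [OF that]] .

  define m where "m = n \<circ> a"
  let ?Q = "sym_product J m" and ?M = "hamming_null J V m"
  interpret M: normal ?M ?Q by (rule hamming_null_normal [OF V])
  define s where "s g = (\<lambda>j\<in>J. r g (a j))" for g
  define f where "f g = ?M #>\<^bsub>?Q\<^esub> s g" for g
  have sc: "s g \<in> carrier ?Q" if "g \<in> carrier G" for g
    using sym_product_carrier_D [OF rc [OF that] aA]
    by (auto simp: s_def sym_product_def sym_group_def m_def)
  have fhom: "f \<in> hom G (metric_ultraproduct J V m)"
  proof (rule homI)
    fix g assume "g \<in> carrier G"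
    then show "f g \<in> carrier (metric_ultraproduct J V m)"
      using sc by (auto simp: f_def metric_ultraproduct_def carrier_FactGroup)
  next
    fix g g' assume g: "g \<in> carrier G" and g': "g' \<in> carrier G"
    have "((\<lambda>j. hamming_dist (m j) (s (g \<otimes>\<^bsub>G\<^esub> g') j) ((s g \<otimes>\<^bsub>?Q\<^esub> s g') j)) \<longlongrightarrow> 0) V"
    proof (rule tendstoI)
      fix e :: real assume "e > 0"
      then obtain k where k: "inverse (real (Suc k)) < e" using reals_Archimedean by blast
      show "eventually (\<lambda>j. dist (hamming_dist (m j) (s (g \<otimes>\<^bsub>G\<^esub> g') j)
              ((s g \<otimes>\<^bsub>?Q\<^esub> s g') j)) 0 < e) V"
        using evV [of "{g, g'}" k, simplified, OF conjI [OF g g']]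
      proof eventually_elim
        case (elim j)
        then have "hamming_dist (n (a j)) (r (g \<otimes>\<^bsub>G\<^esub> g') (a j)) (r g (a j) \<circ> r g' (a j))
            < inverse (real (Suc (snd j)))"
          using a [of j] by (auto simp: good_def split: prod.splits)
        also have "\<dots> \<le> inverse (real (Suc k))" using elim by (simp add: le_imp_inverse_le)
        also note k
        finally show ?case
          using elim by (simp add: s_def m_def sym_product_mult hamming_dist_nonneg)
      qed
    qed
    then have "f (g \<otimes>\<^bsub>G\<^esub> g') = ?M #>\<^bsub>?Q\<^esub> (s g \<otimes>\<^bsub>?Q\<^esub> s g')"
      using g g' by (simp add: f_def hamming_null_rcos_eq_iff [OF V] sc)
    then show "f (g \<otimes>\<^bsub>G\<^esub> g') = f g \<otimes>\<^bsub>metric_ultraproduct J V m\<^esub> f g'"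
      using g g' by (simp add: f_def metric_ultraproduct_def M.rcos_sum sc)
  qed
  have finj: "inj_on f (carrier G)"
  proof (rule inj_onI, rule ccontr)
    fix g g' assume g: "g \<in> carrier G" and g': "g' \<in> carrier G" and eq: "f g = f g'" and ne: "g \<noteq> g'"
    have "((\<lambda>j. hamming_dist (m j) (s g j) (s g' j)) \<longlongrightarrow> 0) V"
      using eq g g' by (simp add: f_def hamming_null_rcos_eq_iff [OF V] sc)
    then have "eventually (\<lambda>j. dist (hamming_dist (m j) (s g j) (s g' j)) 0 < \<delta> g g') V"
      using \<delta>0 [OF g g' ne] by (rule tendstoD)
    moreover have "eventually (\<lambda>j. \<delta> g g' \<le> hamming_dist (m j) (s g j) (s g' j)) V"
      using evV [of "{g, g'}" 0, simplified, OF conjI [OF g g']]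
    proof eventually_elim
      case (elim j)
      then show ?case
        using a [of j] ne by (auto simp: good_def s_def m_def split: prod.splits)
    qed
    ultimately have "eventually (\<lambda>_. False) V"
      by eventually_elim (simp add: hamming_dist_nonneg)
    then show False using V by (simp add: ultrafilter_on_def)
  qed
  have gQ: "group (metric_ultraproduct J V m)" by (rule group_metric_ultraproduct [OF V])
  interpret f: group_hom G "metric_ultraproduct J V m" f
    by (rule group_hom.intro [OF gG gQ group_hom_axioms.intro [OF fhom]])
  have "subgroup (f ` carrier G) (metric_ultraproduct J V m)" by (rule f.img_is_subgroup)
  moreover have "G \<cong> (metric_ultraproduct J V m)\<lparr>carrier := f ` carrier G\<rparr>"
  proof (rule is_isoI)
    show "f \<in> iso G ((metric_ultraproduct J V m)\<lparr>carrier := f ` carrier G\<rparr>)"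
      using fhom finj by (auto simp: iso_def hom_def bij_betw_def)
  qed
  moreover have "\<forall>j\<in>J. m j \<ge> 1" using n1 aA by (simp add: m_def)
  ultimately have "sofic_wrt G J V m" using gG V by (auto simp: sofic_wrt_def)
  then show ?thesis by (auto simp: sofic_def)
qed

end

theory Submission
  imports Defs "HOL-Algebra.Bij" "HOL-Algebra.Weak_Morphisms"
begin

text \<open>In the wreath product of \<open>G\<close> with a cyclic group of order \<open>n\<close>, generated by \<open>\<sigma>\<close>, the element
  \<open>x = (g, 1, \<dots>, 1) \<sigma>\<close> satisfies \<open>x\<^sup>n = (g, \<dots>, g)\<close>, so the diagonal copy of \<open>G\<close> acquires all
  \<open>n\<close>-th roots while periodicity is preserved. Instead of iterating, pass to the direct limit
  of the groups of monomial \<open>N \<times> N\<close> matrices over \<open>G\<close> along the block diagonal embeddings. This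
  limit contains \<open>G\<close>, hence is not sofic either. Its elements are given by finite data over \<open>G\<close>,
  which is infinite because finite groups are sofic, so the limit can be realised on the same
  type.\<close>

section \<open>Soficity of subgroups and of finite groups\<close>

lemma sofic_wrt_if_inj_hom:
  assumes "group G" "ultrafilter_on A U" "\<And>\<alpha>. \<alpha> \<in> A \<Longrightarrow> n \<alpha> \<ge> 1"
    and f: "f \<in> hom G (metric_ultraproduct A U n)" and inj: "inj_on f (carrier G)"
  shows "sofic_wrt G A U n"
proof -
  let ?M = "metric_ultraproduct A U n"
  interpret f: group_hom G ?M f
    using assms group_metric_ultraproduct
    by (intro group_hom.intro group_hom_axioms.intro) auto
  have "f \<in> iso G (?M\<lparr>carrier := f ` carrier G\<rparr>)"
    using f inj by (auto simp: iso_def hom_def bij_betw_def)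
  then show ?thesis
    using assms(1-3) f.img_is_subgroup by (auto simp: sofic_wrt_def intro: is_isoI)
qed

text \<open>Used contrapositively: a group containing a non-sofic group is non-sofic. Composing
  embeddings gives an index set built from the type of \<open>D\<close>;
  \<open>sofic_if_sofic_wrt\<close> replaces it by one built from the type of
  \<open>G\<close>.\<close>

lemma sofic_if_embeds_in_sofic:
  fixes D :: "('c, 'd) monoid_scheme"
  assumes "group G" "sofic D" and f: "f \<in> hom G D" and inj: "inj_on f (carrier G)"
  shows "sofic G"
proof -
  obtain A :: "('c set \<times> nat) set" and U n where D: "sofic_wrt D A U n"
    using assms(2) unfolding sofic_def by blast
  then obtain H h where H: "subgroup H (metric_ultraproduct A U n)"
    and h: "h \<in> iso D ((metric_ultraproduct A U n)\<lparr>carrier := H\<rparr>)"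
    by (auto simp: sofic_wrt_def is_iso_def)
  have "h \<in> hom D (metric_ultraproduct A U n)" "inj_on h (carrier D)"
    using h subgroup.subset [OF H] by (auto simp: iso_def hom_def bij_betw_def)
  then have "h \<circ> f \<in> hom G (metric_ultraproduct A U n)" "inj_on (h \<circ> f) (carrier G)"
    using f inj by (auto simp: hom_def inj_on_def Pi_iff)
  then show ?thesis
    using D assms(1) by (intro sofic_if_sofic_wrt [OF sofic_wrt_if_inj_hom]) (auto simp: sofic_wrt_def)
qed

text \<open>Cayley's theorem: the regular representation embeds \<open>G\<close> into the symmetric
  group of degree \<open>N\<close>, and an ultraproduct over a single index is that symmetric group
  itself.\<close>

lemma sofic_if_finite:
  assumes G: "group G" and fin: "finite (carrier G)"
  shows "sofic G"
proof -
  interpret G: group G by (rule G)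
  define N where "N = card (carrier G)"
  have N: "N \<ge> 1" using fin G.one_closed unfolding N_def by (auto simp: Suc_le_eq card_gt_0_iff)
  obtain e where e: "bij_betw e {1..N} (carrier G)"
    using fin unfolding N_def by (metis bij_betw_iff_card card_atLeastAtMost diff_Suc_1 finite_atLeastAtMost)
  define d where "d = inv_into {1..N} e"
  have d: "bij_betw d (carrier G) {1..N}" unfolding d_def using e by (rule bij_betw_inv_into)
  have ed: "e (d x) = x" if "x \<in> carrier G" for x
    using e that by (simp add: d_def bij_betw_inv_into_right)
  have de: "d (e i) = i" if "i \<in> {1..N}" for i
    using e that by (simp add: d_def bij_betw_inv_into_left)
  have eC: "e i \<in> carrier G" if "i \<in> {1..N}" for i using e that by (auto simp: bij_betw_def)
  have dC: "d x \<in> {1..N}" if "x \<in> carrier G" for x using d that by (auto simp: bij_betw_def)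
  \<comment> \<open>Left multiplication by \<open>g\<close>, carried to \<open>{1..N}\<close> by the
    enumeration \<open>e\<close> and extended by the identity, as \<open>permutes\<close>
    demands.\<close>
  define \<rho> where "\<rho> g i = (if i \<in> {1..N} then d (g \<otimes>\<^bsub>G\<^esub> e i) else i)" for g i
  have \<rho>_mult: "\<rho> (g \<otimes>\<^bsub>G\<^esub> h) = \<rho> g \<circ> \<rho> h" if "g \<in> carrier G" "h \<in> carrier G" for g h
    using that eC dC by (auto simp: \<rho>_def fun_eq_iff ed G.m_assoc)
  have \<rho>_perm: "\<rho> g permutes {1..N}" if g: "g \<in> carrier G" for g
  proof (rule bij_imp_permutes)
    have inverse: "\<rho> a (\<rho> b i) = i"
      if "a \<otimes>\<^bsub>G\<^esub> b = \<one>\<^bsub>G\<^esub>" "a \<in> carrier G" "b \<in> carrier G" "i \<in> {1..N}" for a b i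
    proof -
      have "\<rho> a (\<rho> b i) = \<rho> \<one>\<^bsub>G\<^esub> i" using \<rho>_mult [OF that(2,3)] that(1) by simp
      also have "\<dots> = i" using that(4) eC de by (simp add: \<rho>_def)
      finally show ?thesis .
    qed
    show "bij_betw (\<rho> g) {1..N} {1..N}"
    proof (rule bij_betw_byWitness [where f' = "\<rho> (inv\<^bsub>G\<^esub> g)"])
      show "\<forall>i\<in>{1..N}. \<rho> (inv\<^bsub>G\<^esub> g) (\<rho> g i) = i" "\<forall>i\<in>{1..N}. \<rho> g (\<rho> (inv\<^bsub>G\<^esub> g) i) = i"
        using g by (auto intro!: inverse)
      show "\<rho> g ` {1..N} \<subseteq> {1..N}" "\<rho> (inv\<^bsub>G\<^esub> g) ` {1..N} \<subseteq> {1..N}"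
        using g eC dC by (auto simp: \<rho>_def)
    qed
  qed (auto simp: \<rho>_def)
  \<comment> \<open>Distinct left multiplications agree nowhere, by cancellation, so they are at the
    maximal distance.\<close>
  have dist: "hamming_dist N (\<rho> g) (\<rho> h) = 1" if "g \<in> carrier G" "h \<in> carrier G" "g \<noteq> h" for g h
  proof -
    have "\<rho> g i \<noteq> \<rho> h i" if i: "i \<in> {1..N}" for i
    proof
      assume "\<rho> g i = \<rho> h i"
      then have "e (d (g \<otimes>\<^bsub>G\<^esub> e i)) = e (d (h \<otimes>\<^bsub>G\<^esub> e i))" using i by (simp add: \<rho>_def)
      then show False using \<open>g \<in> carrier G\<close> \<open>h \<in> carrier G\<close> \<open>g \<noteq> h\<close> eC [OF i] by (simp add: ed)
    qed
    then have "{i \<in> {1..N}. \<rho> g i \<noteq> \<rho> h i} = {1..N}" by blast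
    then show ?thesis using N by (simp add: hamming_dist_def)
  qed
  define U :: "unit filter" where "U = principal {()}"
  have U: "ultrafilter_on UNIV U"
    by (auto simp: ultrafilter_on_def U_def eventually_principal principal_eq_bot_iff)
  let ?n = "\<lambda>_::unit. N"
  let ?P = "sym_product UNIV ?n" and ?M = "hamming_null UNIV U ?n"
  interpret M: normal ?M ?P by (rule hamming_null_normal [OF U])
  define s where "s g = (\<lambda>_::unit. \<rho> g)" for g
  have sc: "s g \<in> carrier ?P" if "g \<in> carrier G" for g
    using \<rho>_perm [OF that] by (simp add: s_def sym_product_def sym_group_def PiE_UNIV_domain)
  define f where "f g = ?M #>\<^bsub>?P\<^esub> s g" for g
  have "f \<in> hom G (metric_ultraproduct UNIV U ?n)"
  proof (rule homI)
    fix g assume "g \<in> carrier G"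
    then show "f g \<in> carrier (metric_ultraproduct UNIV U ?n)"
      using sc by (auto simp: f_def metric_ultraproduct_def carrier_FactGroup)
  next
    fix g h assume gh: "g \<in> carrier G" "h \<in> carrier G"
    then have "s (g \<otimes>\<^bsub>G\<^esub> h) = s g \<otimes>\<^bsub>?P\<^esub> s h"
      by (auto simp: fun_eq_iff s_def sym_product_mult \<rho>_mult)
    then show "f (g \<otimes>\<^bsub>G\<^esub> h) = f g \<otimes>\<^bsub>metric_ultraproduct UNIV U ?n\<^esub> f h"
      using gh by (simp add: f_def metric_ultraproduct_def M.rcos_sum sc)
  qed
  moreover have "inj_on f (carrier G)"
  proof (rule inj_onI, rule ccontr)
    fix g h assume gh: "g \<in> carrier G" "h \<in> carrier G" "f g = f h" "g \<noteq> h"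
    then have "((\<lambda>\<alpha>::unit. 1::real) \<longlongrightarrow> 0) U"
      using hamming_null_rcos_eq_iff [OF U sc sc, of g h] by (simp add: f_def s_def dist)
    then show False
      using U by (simp add: tendsto_const_iff ultrafilter_on_def)
  qed
  ultimately show ?thesis
    using G U N by (intro sofic_if_sofic_wrt [OF sofic_wrt_if_inj_hom]) auto
qed

section \<open>Finite data over an infinite type\<close>

text \<open>For infinite \<open>'a\<close> there is an injective pairing of
  \<open>'a \<times> 'a\<close> into \<open>'a\<close>; iterating it along a list codes lists of one
  fixed length.\<close>

lemma ex_inj_list_infinite:
  includes cardinal_syntax
  fixes q :: "'b \<Rightarrow> 'a"
  assumes inf: "infinite (UNIV :: 'a set)" and q: "inj q"
  shows "\<exists>f :: 'b list \<Rightarrow> 'a. inj f"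
proof -
  have "|UNIV \<times> UNIV :: ('a \<times> 'a) set| \<le>o |UNIV :: 'a set|"
    using card_of_Times_same_infinite [OF inf] by (rule ordIso_imp_ordLeq)
  then obtain p :: "'a \<times> 'a \<Rightarrow> 'a" where p: "inj p"
    by (auto simp: card_of_ordLeq [symmetric])
  obtain c :: "nat \<Rightarrow> 'a" where c: "inj c"
    using inf by (auto simp: infinite_iff_countable_subset)
  \<comment> \<open>The fold starts from the arbitrary value \<open>c 0\<close>, so it need not
    reveal where the list ends; the final code therefore also records the length.\<close>
  define e where "e = (\<lambda>xs. foldr (\<lambda>x a. p (q x, a)) xs (c 0))"
  have e: "xs = ys" if "length xs = length ys" "e xs = e ys" for xs ys
    using that by (induction xs ys rule: list_induct2) (auto simp: e_def inj_eq [OF p] inj_eq [OF q])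
  have "inj (\<lambda>xs. p (c (length xs), e xs))"
    by (auto intro!: injI e simp: inj_eq [OF p] inj_eq [OF c])
  then show ?thesis by blast
qed

lemma ex_inj_int_Times_list_infinite:
  assumes inf: "infinite (UNIV :: 'a set)"
  shows "\<exists>f :: (int \<times> 'a) list \<Rightarrow> 'a. inj f"
proof -
  obtain f :: "'a list \<Rightarrow> 'a" where f: "inj f"
    using ex_inj_list_infinite [OF inf inj_on_id] by blast
  obtain c :: "nat \<Rightarrow> 'a" where c: "inj c"
    using inf by (auto simp: infinite_iff_countable_subset)
  \<comment> \<open>A pair is coded as a list of two elements, which makes the previous lemma
    applicable a second time, now to lists of pairs.\<close>
  have "inj (\<lambda>(i::int, a). f [c (to_nat i), a])"
    by (auto intro!: injI simp: inj_eq [OF f] inj_eq [OF c])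
  then show ?thesis by (rule ex_inj_list_infinite [OF inf])
qed

section \<open>The limit of the monomial groups\<close>

text \<open>A monomial \<open>N \<times> N\<close> matrix over \<open>G\<close> is a bijection of \<open>{0..<N} \<times> G\<close> commuting with
  right multiplication. Repeating it with period \<open>N\<close> along the integers identifies it with all
  its block diagonal powers, so that the direct limit becomes a union.\<close>

definition points :: "('a, 'b) monoid_scheme \<Rightarrow> (int \<times> 'a) set" where
  "points G = UNIV \<times> carrier G"

definition translate :: "('a, 'b) monoid_scheme \<Rightarrow> int \<Rightarrow> 'a \<Rightarrow> int \<times> 'a \<Rightarrow> int \<times> 'a" where
  "translate G k h z = (fst z + k, snd z \<otimes>\<^bsub>G\<^esub> h)"

text \<open>The first condition combines period \<open>N\<close> in the index with equivariance
  under right multiplication. The second keeps each block of \<open>N\<close> consecutive indices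
  invariant, so the infinite matrix is block diagonal with equal blocks. Members of
  \<open>Bij\<close> are extensional, so they are determined by their values on
  \<open>points G\<close>.\<close>

definition monomials :: "('a, 'b) monoid_scheme \<Rightarrow> int \<Rightarrow> (int \<times> 'a \<Rightarrow> int \<times> 'a) set" where
  "monomials G N = {\<phi> \<in> Bij (points G).
     (\<forall>k. \<forall>h\<in>carrier G. \<forall>z\<in>points G. \<phi> (translate G (N * k) h z) = translate G (N * k) h (\<phi> z)) \<and>
     (\<forall>z\<in>points G. fst (\<phi> z) div N = fst z div N)}"

definition monomial_limit :: "('a, 'b) monoid_scheme \<Rightarrow> (int \<times> 'a \<Rightarrow> int \<times> 'a) monoid" where
  "monomial_limit G = (BijGroup (points G))\<lparr>carrier := \<Union>N\<in>{1..}. monomials G N\<rparr>"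

context group
begin

section \<open>The group structure on the union of the monomial groups\<close>

lemma translate_points: "z \<in> points G \<Longrightarrow> h \<in> carrier G \<Longrightarrow> translate G k h z \<in> points G"
  by (auto simp: points_def translate_def)

lemma fst_translate [simp]: "fst (translate G k h z) = fst z + k"
  by (simp add: translate_def)

lemma translate_translate:
  "z \<in> points G \<Longrightarrow> h \<in> carrier G \<Longrightarrow> h' \<in> carrier G \<Longrightarrow>
     translate G k h (translate G k' h' z) = translate G (k' + k) (h' \<otimes> h) z"
  by (auto simp: points_def translate_def m_assoc)

lemma translate_zero_one: "z \<in> points G \<Longrightarrow> translate G 0 \<one> z = z"
  by (auto simp: points_def translate_def)

lemma monomials_points: "\<phi> \<in> monomials G N \<Longrightarrow> z \<in> points G \<Longrightarrow> \<phi> z \<in> points G"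
  using Bij_imp_funcset [of \<phi> "points G"] by (auto simp: monomials_def)

lemma monomials_translate:
  "\<phi> \<in> monomials G N \<Longrightarrow> h \<in> carrier G \<Longrightarrow> z \<in> points G \<Longrightarrow> N dvd k \<Longrightarrow>
     \<phi> (translate G k h z) = translate G k h (\<phi> z)"
  by (auto simp: monomials_def)

lemma monomials_div:
  "\<phi> \<in> monomials G N \<Longrightarrow> z \<in> points G \<Longrightarrow> fst (\<phi> z) div N = fst z div N"
  by (auto simp: monomials_def)

lemma monomials_Bij: "\<phi> \<in> monomials G N \<Longrightarrow> \<phi> \<in> Bij (points G)"
  by (simp add: monomials_def)

lemma monomials_inj: "\<phi> \<in> monomials G N \<Longrightarrow> inj_on \<phi> (points G)"
  by (simp add: monomials_def Bij_def bij_betw_def)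

lemma monomialsI:
  assumes "\<phi> \<in> Bij (points G)"
    and "\<And>k h z. h \<in> carrier G \<Longrightarrow> z \<in> points G \<Longrightarrow> N dvd k \<Longrightarrow> \<phi> (translate G k h z) = translate G k h (\<phi> z)"
    and "\<And>z. z \<in> points G \<Longrightarrow> fst (\<phi> z) div N = fst z div N"
  shows "\<phi> \<in> monomials G N"
  using assms by (auto simp: monomials_def)

text \<open>Blocks of size \<open>N * M\<close> are unions of blocks of size \<open>N\<close>, and
  multiples of \<open>N * M\<close> are multiples of \<open>N\<close>. Hence the family is directed
  under divisibility.\<close>

lemma monomials_mono:
  assumes "N \<ge> 1" "M \<ge> 1" "\<phi> \<in> monomials G N"
  shows "\<phi> \<in> monomials G (N * M)"
proof (rule monomialsI)
  fix k h z assume "h \<in> carrier G" "z \<in> points G" "N * M dvd k"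
  then show "\<phi> (translate G k h z) = translate G k h (\<phi> z)"
    by (intro monomials_translate [OF assms(3)]) (auto elim: dvd_mult_left)
next
  fix z assume "z \<in> points G"
  then show "fst (\<phi> z) div (N * M) = fst z div (N * M)"
    using assms by (simp add: zdiv_zmult2_eq monomials_div)
qed (use assms monomials_Bij in auto)

lemma monomials_compose:
  assumes "\<phi> \<in> monomials G N" "\<psi> \<in> monomials G N"
  shows "compose (points G) \<phi> \<psi> \<in> monomials G N"
proof (rule monomialsI)
  show "compose (points G) \<phi> \<psi> \<in> Bij (points G)"
    using assms by (intro compose_Bij monomials_Bij)
qed (use assms in \<open>auto simp: compose_def monomials_translate translate_points monomials_points monomials_div\<close>)

lemma monomials_inv_into:
  assumes \<phi>: "\<phi> \<in> monomials G N"
  shows "(\<lambda>z\<in>points G. inv_into (points G) \<phi> z) \<in> monomials G N"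
proof -
  let ?i = "inv_into (points G) \<phi>"
  have b: "bij_betw \<phi> (points G) (points G)" using monomials_Bij [OF \<phi>] by (simp add: Bij_def)
  have i: "?i z \<in> points G" "\<phi> (?i z) = z" if "z \<in> points G" for z
    using b that by (auto simp: bij_betw_inv_into_right Bij_inv_into_mem [OF monomials_Bij [OF \<phi>]])
  show ?thesis
  proof (rule monomialsI)
    fix k h z assume a: "h \<in> carrier G" "z \<in> points G" "N dvd k"
    have "\<phi> (translate G k h (?i z)) = translate G k h z"
      using a i by (simp add: monomials_translate [OF \<phi>])
    then have "?i (translate G k h z) = translate G k h (?i z)"
      using a i by (intro inv_into_f_eq [OF monomials_inj [OF \<phi>]] translate_points) auto
    then show "restrict ?i (points G) (translate G k h z) = translate G k h (restrict ?i (points G) z)"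
      using a by (simp add: translate_points)
  next
    fix z assume "z \<in> points G"
    then show "fst (restrict ?i (points G) z) div N = fst z div N"
      using monomials_div [OF \<phi> i(1)] i(2) by simp
  qed (rule restrict_inv_into_Bij [OF monomials_Bij [OF \<phi>]])
qed

lemma id_monomials: "(\<lambda>z\<in>points G. z) \<in> monomials G N"
  by (rule monomialsI) (auto simp: id_Bij translate_points)

lemma monomials_subgroup: "subgroup (\<Union>N\<in>{1..}. monomials G N) (BijGroup (points G))"
proof -
  interpret B: group "BijGroup (points G)" by (rule group_BijGroup)
  show ?thesis
  proof (rule B.subgroupI)
    show "(\<Union>N\<in>{1..}. monomials G N) \<subseteq> carrier (BijGroup (points G))"
      by (auto simp: BijGroup_def monomials_def)
    show "(\<Union>N\<in>{1..}. monomials G N) \<noteq> {}" using id_monomials by fastforce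
  next
    fix \<phi> assume "\<phi> \<in> (\<Union>N\<in>{1..}. monomials G N)"
    then obtain N where N: "N \<ge> 1" "\<phi> \<in> monomials G N" by auto
    have "inv\<^bsub>BijGroup (points G)\<^esub> \<phi> = (\<lambda>z\<in>points G. inv_into (points G) \<phi> z)"
      using monomials_Bij [OF N(2)] by (rule inv_BijGroup)
    then show "inv\<^bsub>BijGroup (points G)\<^esub> \<phi> \<in> (\<Union>N\<in>{1..}. monomials G N)"
      using N monomials_inv_into by auto
  next
    fix \<phi> \<psi> assume "\<phi> \<in> (\<Union>N\<in>{1..}. monomials G N)" "\<psi> \<in> (\<Union>N\<in>{1..}. monomials G N)"
    then obtain N M where N: "N \<ge> 1" "\<phi> \<in> monomials G N" and M: "M \<ge> 1" "\<psi> \<in> monomials G M" by auto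
    \<comment> \<open>Both factors are moved to the common block size \<open>N * M\<close>, where
      products are already available.\<close>
    have "\<phi> \<in> monomials G (N * M)" using N M by (intro monomials_mono)
    moreover have "\<psi> \<in> monomials G (N * M)"
      using monomials_mono [OF M(1) N(1) M(2)] by (simp add: mult.commute)
    ultimately have "compose (points G) \<phi> \<psi> \<in> monomials G (N * M)" by (rule monomials_compose)
    moreover have "N * M \<ge> 1" using mult_mono [of 1 N 1 M] N M by simp
    ultimately show "\<phi> \<otimes>\<^bsub>BijGroup (points G)\<^esub> \<psi> \<in> (\<Union>N\<in>{1..}. monomials G N)"
      using monomials_Bij N M by (auto simp: BijGroup_def)
  qed
qed

lemma group_monomial_limit: "group (monomial_limit G)"
  unfolding monomial_limit_def
  by (rule subgroup.subgroup_is_group [OF monomials_subgroup group_BijGroup])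

lemma carrier_monomial_limit: "carrier (monomial_limit G) = (\<Union>N\<in>{1..}. monomials G N)"
  by (simp add: monomial_limit_def)

lemma monomial_limit_Bij: "\<phi> \<in> carrier (monomial_limit G) \<Longrightarrow> \<phi> \<in> Bij (points G)"
  by (auto simp: carrier_monomial_limit monomials_def)

lemma monomial_limit_mult:
  "\<phi> \<in> carrier (monomial_limit G) \<Longrightarrow> \<psi> \<in> carrier (monomial_limit G) \<Longrightarrow>
     \<phi> \<otimes>\<^bsub>monomial_limit G\<^esub> \<psi> = compose (points G) \<phi> \<psi>"
  using monomial_limit_Bij [of \<phi>] monomial_limit_Bij [of \<psi>]
  by (simp only: monomial_limit_def BijGroup_def monoid.simps partial_object.simps restrict_apply')

lemma monomial_limit_one: "\<one>\<^bsub>monomial_limit G\<^esub> = (\<lambda>z\<in>points G. z)"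
  by (simp add: monomial_limit_def BijGroup_def)

lemma monomial_limit_ext:
  assumes "\<phi> \<in> carrier (monomial_limit G)" "\<psi> \<in> carrier (monomial_limit G)"
    and "\<And>z. z \<in> points G \<Longrightarrow> \<phi> z = \<psi> z"
  shows "\<phi> = \<psi>"
  using monomial_limit_Bij [OF assms(1)] monomial_limit_Bij [OF assms(2)] assms(3)
  by (intro extensionalityI [of _ "points G"] Bij_imp_extensional)

lemma funpow_closed: "f \<in> A \<rightarrow> A \<Longrightarrow> z \<in> A \<Longrightarrow> (f ^^ n) z \<in> A"
  by (induction n) (simp_all add: Pi_iff)

text \<open>Turns powers in the group into plain iteration of maps, so that orders and roots can be
  studied along orbits of points.\<close>

lemma monomial_limit_pow:
  assumes \<phi>: "\<phi> \<in> carrier (monomial_limit G)" and z: "z \<in> points G"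
  shows "(\<phi> [^]\<^bsub>monomial_limit G\<^esub> (n::nat)) z = (\<phi> ^^ n) z"
  using z
proof (induction n arbitrary: z)
  case 0
  then show ?case by (simp add: monomial_limit_one)
next
  case (Suc n)
  interpret L: group "monomial_limit G" by (rule group_monomial_limit)
  have "\<phi> z \<in> points G" using Suc.prems Bij_imp_funcset [OF monomial_limit_Bij [OF \<phi>]] by auto
  then show ?case
    using Suc \<phi> by (simp add: monomial_limit_mult compose_def funpow_swap1)
qed

text \<open>Left multiplication commutes with right multiplication and fixes the index, so the
  diagonal copy of \<open>G\<close> already lives at block size 1.\<close>

lemma embed_monomials:
  assumes g: "g \<in> carrier G"
  shows "(\<lambda>z\<in>points G. (fst z, g \<otimes> snd z)) \<in> monomials G 1"
proof (rule monomialsI)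
  have cancel: "inv g \<otimes> (g \<otimes> b) = b" "g \<otimes> (inv g \<otimes> b) = b" if "b \<in> carrier G" for b
    using g that by (simp_all flip: m_assoc)
  have "bij_betw (\<lambda>z. (fst z, g \<otimes> snd z)) (points G) (points G)"
    by (rule bij_betw_byWitness [where f' = "\<lambda>z. (fst z, inv g \<otimes> snd z)"])
       (use g in \<open>simp_all add: points_def mem_Times_iff cancel image_subset_iff\<close>)
  then show "(\<lambda>z\<in>points G. (fst z, g \<otimes> snd z)) \<in> Bij (points G)"
    by (simp add: Bij_def)
next
  fix k h z assume "h \<in> carrier G" "z \<in> points G"
  then show "(\<lambda>z\<in>points G. (fst z, g \<otimes> snd z)) (translate G k h z) =
      translate G k h ((\<lambda>z\<in>points G. (fst z, g \<otimes> snd z)) z)"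
    using g by (simp add: points_def translate_def mem_Times_iff m_assoc)
qed simp

lemma embed_hom:
  "(\<lambda>g. \<lambda>z\<in>points G. (fst z, g \<otimes> snd z)) \<in> hom G (monomial_limit G)"
proof (rule homI)
  show *: "(\<lambda>z\<in>points G. (fst z, g \<otimes> snd z)) \<in> carrier (monomial_limit G)" if "g \<in> carrier G" for g
    unfolding carrier_monomial_limit using embed_monomials [OF that] by (intro UN_I [of 1]) simp_all
  fix g h assume gh: "g \<in> carrier G" "h \<in> carrier G"
  show "(\<lambda>z\<in>points G. (fst z, g \<otimes> h \<otimes> snd z)) =
      (\<lambda>z\<in>points G. (fst z, g \<otimes> snd z)) \<otimes>\<^bsub>monomial_limit G\<^esub> (\<lambda>z\<in>points G. (fst z, h \<otimes> snd z))"
    unfolding monomial_limit_mult [OF * [OF gh(1)] * [OF gh(2)]]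
    using gh by (intro ext) (simp add: compose_def restrict_def points_def mem_Times_iff m_assoc)
qed

lemma embed_inj: "inj_on (\<lambda>g. \<lambda>z\<in>points G. (fst z, g \<otimes> snd z)) (carrier G)"
proof (rule inj_onI)
  fix g h assume gh: "g \<in> carrier G" "h \<in> carrier G"
    and "(\<lambda>z\<in>points G. (fst z, g \<otimes> snd z)) = (\<lambda>z\<in>points G. (fst z, h \<otimes> snd z))"
  from fun_cong [OF this(3), of "(0, \<one>)"] show "g = h" using gh by (simp add: points_def)
qed

section \<open>Coding elements of the limit by finite lists\<close>

lemma points_eq_translate:
  assumes "z \<in> points G"
  shows "z = translate G (N * (fst z div N)) (snd z) (fst z mod N, \<one>)"
  using assms by (auto simp: points_def translate_def)

text \<open>Every point is an admissible translate of some \<open>(i, \<one>)\<close> with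
  \<open>0 \<le> i < N\<close>, so an element is determined by \<open>N\<close> and its values at
  these \<open>N\<close> representatives.\<close>

lemma monomial_limit_lists:
  "\<exists>c :: (int \<times> 'a \<Rightarrow> int \<times> 'a) \<Rightarrow> (int \<times> 'a) list. inj_on c (carrier (monomial_limit G))"
proof -
  have "\<forall>\<phi>\<in>carrier (monomial_limit G). \<exists>N. N \<ge> 1 \<and> \<phi> \<in> monomials G N"
    by (auto simp: carrier_monomial_limit)
  from bchoice [OF this] obtain P where
    P: "\<And>\<phi>. \<phi> \<in> carrier (monomial_limit G) \<Longrightarrow> P \<phi> \<ge> 1 \<and> \<phi> \<in> monomials G (P \<phi>)" by blast
  define c where "c \<phi> = map (\<lambda>i. \<phi> (i, \<one>)) [0..P \<phi> - 1]" for \<phi>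
  have "inj_on c (carrier (monomial_limit G))"
  proof (rule inj_onI)
    fix \<phi> \<psi> assume \<phi>: "\<phi> \<in> carrier (monomial_limit G)" and \<psi>: "\<psi> \<in> carrier (monomial_limit G)"
      and eq: "c \<phi> = c \<psi>"
    define N where "N = P \<phi>"
    \<comment> \<open>The list has length \<open>P \<phi>\<close>, since
      \<open>P \<phi> \<ge> 1\<close>; thus the code also recovers the chosen block size.\<close>
    have "length (c \<phi>) = length (c \<psi>)" using eq by simp
    then have N': "P \<psi> = N" using P [OF \<phi>] P [OF \<psi>] by (simp add: c_def N_def eq_nat_nat_iff)
    have m: "\<phi> \<in> monomials G N" "\<psi> \<in> monomials G N" "N \<ge> 1"
      using P [OF \<phi>] P [OF \<psi>] N' by (auto simp: N_def)
    have eq': "\<phi> (i, \<one>) = \<psi> (i, \<one>)" if "0 \<le> i" "i < N" for i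
      using eq that by (simp add: c_def N' N_def [symmetric])
    show "\<phi> = \<psi>"
    proof (rule monomial_limit_ext [OF \<phi> \<psi>])
      fix z assume z: "z \<in> points G"
      have "snd z \<in> carrier G" "(fst z mod N, \<one>) \<in> points G" using z by (auto simp: points_def)
      then show "\<phi> z = \<psi> z"
        using m by (subst (1 2) points_eq_translate [OF z, of N]) (simp add: monomials_translate eq')
    qed
  qed
  then show ?thesis by blast
qed

subsection \<open>Periodicity\<close>

lemma funpow_translate:
  assumes \<phi>: "\<phi> \<in> monomials G N" and "h \<in> carrier G" "z \<in> points G" "N dvd k"
  shows "(\<phi> ^^ n) (translate G k h z) = translate G k h ((\<phi> ^^ n) z)"
  using assms monomials_points [OF \<phi>]
  by (induction n) (auto simp: monomials_translate funpow_closed)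

lemma funpow_period_mult: "(f ^^ n) z = z \<Longrightarrow> (f ^^ (n * m)) z = z"
  by (induction m) (auto simp: funpow_add)

text \<open>The orbit stays in one block, so by the pigeonhole principle some index recurs. Between
  the two visits the group coordinate changes by right multiplication with some \<open>w\<close>,
  and \<open>w\<close> has finite order.\<close>

lemma monomials_point_periodic:
  assumes per: "periodic_group G" and N: "N \<ge> 1" and \<phi>: "\<phi> \<in> monomials G N" and z: "z \<in> points G"
  shows "\<exists>e\<ge>1. (\<phi> ^^ e) z = z"
proof -
  have cl: "(\<phi> ^^ n) z \<in> points G" for n
    using z monomials_points [OF \<phi>] by (intro funpow_closed) auto
  have div: "fst ((\<phi> ^^ n) z) div N = fst z div N" for n
    by (induction n) (auto simp: monomials_div [OF \<phi> cl])
  have "range (\<lambda>n. fst ((\<phi> ^^ n) z)) \<subseteq> (\<lambda>r. N * (fst z div N) + r) ` {0..<N}"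
  proof (rule image_subsetI)
    fix n
    have "fst ((\<phi> ^^ n) z) = N * (fst z div N) + fst ((\<phi> ^^ n) z) mod N"
      using div [of n] by (metis mult_div_mod_eq)
    then show "fst ((\<phi> ^^ n) z) \<in> (\<lambda>r. N * (fst z div N) + r) ` {0..<N}"
      using N by (intro image_eqI) auto
  qed
  then have "finite (range (\<lambda>n. fst ((\<phi> ^^ n) z)))" by (rule finite_subset) simp
  then have "\<not> inj (\<lambda>n. fst ((\<phi> ^^ n) z))"
    using finite_imageD infinite_UNIV_nat by blast
  then obtain a b :: nat where ab: "a < b" "fst ((\<phi> ^^ a) z) = fst ((\<phi> ^^ b) z)"
    by (auto simp: inj_on_def) (metis linorder_neqE_nat)
  define y where "y = (\<phi> ^^ a) z"
  define w where "w = inv (snd y) \<otimes> snd ((\<phi> ^^ b) z)"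
  have y: "y \<in> points G" using cl by (simp add: y_def)
  have yc: "snd y \<in> carrier G" "snd ((\<phi> ^^ b) z) \<in> carrier G"
    using y cl [of b] by (auto simp: points_def)
  then have w: "w \<in> carrier G" by (simp add: w_def)
  have step: "(\<phi> ^^ (b - a)) y = translate G 0 w y"
  proof -
    have "(\<phi> ^^ (b - a)) y = (\<phi> ^^ b) z" using ab by (simp add: y_def flip: funpow_add comp_apply [of "\<phi> ^^ _"])
    then show ?thesis using ab yc by (simp add: translate_def w_def y_def prod_eq_iff flip: m_assoc)
  qed
  \<comment> \<open>As \<open>\<phi>\<close> commutes with right multiplication, each further return
    to the index contributes another factor \<open>w\<close>.\<close>
  have steps: "(\<phi> ^^ ((b - a) * t)) y = translate G 0 (w [^] t) y" for t :: nat
  proof (induction t)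
    case 0
    then show ?case using y by (simp add: translate_zero_one)
  next
    case (Suc t)
    have "(\<phi> ^^ ((b - a) * Suc t)) y = (\<phi> ^^ (b - a)) ((\<phi> ^^ ((b - a) * t)) y)"
      by (simp add: funpow_add)
    also have "\<dots> = translate G 0 (w [^] t) (translate G 0 w y)"
      using w y by (simp add: Suc step funpow_translate [OF \<phi>])
    also have "\<dots> = translate G 0 (w [^] Suc t) y"
      using w y nat_pow_Suc2 [OF w, of t] by (simp add: translate_translate)
    finally show ?case .
  qed
  obtain t :: nat where t: "t \<ge> 1" "w [^] t = \<one>" using per w by (auto simp: periodic_group_def)
  \<comment> \<open>So far only \<open>y\<close>, the \<open>a\<close>-th iterate of
    \<open>z\<close>, is known to be periodic; injectivity of that iterate carries the period back
    to \<open>z\<close>.\<close>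
  have "(\<phi> ^^ a) ((\<phi> ^^ ((b - a) * t)) z) = (\<phi> ^^ a) z"
  proof -
    have "(\<phi> ^^ a) ((\<phi> ^^ ((b - a) * t)) z) = (\<phi> ^^ ((b - a) * t)) y"
      by (simp add: y_def add.commute flip: funpow_add comp_apply [of "\<phi> ^^ _"])
    also have "\<dots> = y" using steps [of t] t y by (simp add: translate_zero_one)
    finally show ?thesis by (simp add: y_def)
  qed
  moreover have "inj_on (\<phi> ^^ a) (points G)"
    using monomials_Bij [OF \<phi>] by (intro bij_betw_imp_inj_on [OF bij_betw_funpow]) (simp add: Bij_def)
  ultimately have "(\<phi> ^^ ((b - a) * t)) z = z"
    using cl z by (auto dest: inj_onD)
  moreover have "(b - a) * t \<ge> 1" using ab t by (simp add: Suc_le_eq)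
  ultimately show ?thesis by blast
qed

lemma periodic_monomial_limit:
  assumes per: "periodic_group G"
  shows "periodic_group (monomial_limit G)"
  unfolding periodic_group_def
proof (intro conjI ballI group_monomial_limit)
  interpret L: group "monomial_limit G" by (rule group_monomial_limit)
  fix \<phi> assume \<phi>: "\<phi> \<in> carrier (monomial_limit G)"
  then obtain N where N: "N \<ge> 1" "\<phi> \<in> monomials G N" by (auto simp: carrier_monomial_limit)
  have "\<exists>e\<ge>1. (\<phi> ^^ e) (i, \<one>) = (i, \<one>)" for i
    by (rule monomials_point_periodic [OF per N]) (simp add: points_def)
  then obtain e where e: "\<And>i. e i \<ge> (1::nat)" "\<And>i. (\<phi> ^^ e i) (i, \<one>) = (i, \<one>)" by metis
  \<comment> \<open>A common multiple of the periods of the \<open>N\<close> representatives. All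
    other points are translates of these and inherit the period.\<close>
  define E where "E = (\<Prod>i\<in>{0..<N}. e i)"
  have "\<phi> [^]\<^bsub>monomial_limit G\<^esub> E = \<one>\<^bsub>monomial_limit G\<^esub>"
  proof (rule monomial_limit_ext)
    fix z assume z: "z \<in> points G"
    define y where "y = (fst z mod N, \<one>)"
    have y: "y \<in> points G" "snd z \<in> carrier G" using z by (auto simp: points_def y_def)
    have "e (fst z mod N) dvd E" unfolding E_def using N by (intro dvd_prodI) auto
    then have "(\<phi> ^^ E) y = y"
      using e(2) [of "fst z mod N"] by (auto simp: y_def intro: funpow_period_mult elim!: dvdE)
    then have "(\<phi> ^^ E) (translate G (N * (fst z div N)) (snd z) y) = translate G (N * (fst z div N)) (snd z) y"
      using y by (simp add: funpow_translate [OF N(2)])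
    then have "(\<phi> ^^ E) z = z" using points_eq_translate [OF z, of N] by (simp add: y_def)
    then show "(\<phi> [^]\<^bsub>monomial_limit G\<^esub> E) z = \<one>\<^bsub>monomial_limit G\<^esub> z"
      using \<phi> z by (simp add: monomial_limit_pow monomial_limit_one)
  qed (use \<phi> in auto)
  moreover have "E \<ge> 1" using e(1) unfolding E_def by (intro prod_ge_1) auto
  ultimately show "\<exists>n::nat. n \<ge> 1 \<and> \<phi> [^]\<^bsub>monomial_limit G\<^esub> n = \<one>\<^bsub>monomial_limit G\<^esub>" by blast
qed

subsection \<open>Divisibility\<close>

text \<open>The root cyclically shifts the \<open>n\<close> blocks of size \<open>N\<close> inside a block of size \<open>N * n\<close> and
  applies \<open>\<phi>\<close> when it wraps around, so that \<open>n\<close> steps return to the same block and meet \<open>\<phi>\<close>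
  exactly once.\<close>

lemma monomials_root:
  assumes N: "N \<ge> 1" and \<phi>: "\<phi> \<in> monomials G N" and n: "n \<ge> (1::nat)"
  shows "\<exists>\<xi>\<in>monomials G (N * int n). \<forall>z\<in>points G. (\<xi> ^^ n) z = \<phi> z"
proof -
  \<comment> \<open>The position, from \<open>0\<close> to \<open>n - 1\<close>, of the small block
    of \<open>z\<close> inside its large block of size \<open>N * n\<close>.\<close>
  let ?b = "\<lambda>z. fst z div N mod int n"
  let ?t = "\<lambda>k. translate G (N * k) \<one>"
  \<comment> \<open>The wrap-around shift \<open>1 - int n\<close> cancels the \<open>n - 1\<close>
    unit shifts of a full cycle.\<close>
  define \<xi> where "\<xi> = (\<lambda>z\<in>points G. if ?b z = int n - 1 then ?t (1 - int n) (\<phi> z) else ?t 1 z)"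
  have tp: "?t k z \<in> points G" if "z \<in> points G" for k z using that by (simp add: translate_points)
  have div_t: "fst (?t k z) div N = fst z div N + k" for k z using N by simp
  have b_t: "?b (?t k z) = (?b z + k) mod int n" for k z
    by (simp only: div_t mod_add_left_eq)
  have \<phi>t: "\<phi> (?t k z) = ?t k (\<phi> z)" if "z \<in> points G" for k z
    using that by (simp add: monomials_translate [OF \<phi>])
  have tt: "?t k (?t k' z) = ?t (k' + k) z" if "z \<in> points G" for k k' z
    using that by (simp add: translate_translate distrib_left)
  have \<xi>p: "\<xi> z \<in> points G" if "z \<in> points G" for z
    using that monomials_points [OF \<phi>] by (simp add: \<xi>_def translate_points)
  \<comment> \<open>Arriving at the last position is allowed: \<open>\<phi>\<close> is applied only
    on leaving it.\<close>
  have shift: "(\<xi> ^^ k) z = ?t (int k) z" if "z \<in> points G" "?b z + int k < int n" for k z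
    using that(2)
  proof (induction k)
    case 0
    then show ?case using that by (simp add: translate_zero_one)
  next
    case (Suc k)
    have "?b (?t (int k) z) = ?b z + int k"
      using Suc.prems n unfolding b_t by (intro mod_pos_pos_trivial) auto
    then have "?b (?t (int k) z) \<noteq> int n - 1" using Suc.prems by simp
    then have "\<xi> (?t (int k) z) = ?t 1 (?t (int k) z)" using that tp by (simp add: \<xi>_def)
    then show ?case using Suc that tt [of z 1 "int k"] by (simp add: add.commute)
  qed
  have root: "(\<xi> ^^ n) z = \<phi> z" if z: "z \<in> points G" for z
  proof -
    \<comment> \<open>From position \<open>j\<close>, the \<open>n\<close> steps split into
      \<open>k\<close> shifts to the last position, one wrap to position 0, and \<open>j\<close>
      shifts back to position \<open>j\<close>.\<close>
    define j where "j = nat (?b z)"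
    have j: "int j = ?b z" "j < n" using n by (auto simp: j_def nat_less_iff)
    define k where "k = n - 1 - j"
    have k: "int k = int n - 1 - int j" "n = j + Suc k" using j n by (auto simp: k_def)
    have bk: "?b z + int k = int n - 1" using j(1) k(1) by linarith
    then have 1: "(\<xi> ^^ k) z = ?t (int k) z" using z by (intro shift) auto
    have "?b (?t (int k) z) = int n - 1" using n unfolding b_t bk by (intro mod_pos_pos_trivial) auto
    then have "\<xi> (?t (int k) z) = ?t (1 - int n) (\<phi> (?t (int k) z))"
      using tp z by (simp add: \<xi>_def)
    also have "\<dots> = ?t (- int j) (\<phi> z)"
      using z k(1) monomials_points [OF \<phi>] by (simp add: \<phi>t tt)
    finally have 2: "(\<xi> ^^ Suc k) z = ?t (- int j) (\<phi> z)" by (simp add: 1)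
    have \<phi>z: "\<phi> z \<in> points G" using monomials_points [OF \<phi> z] .
    have "?b (?t (- int j) (\<phi> z)) = (fst z div N - fst z div N mod int n) mod int n"
      unfolding div_t monomials_div [OF \<phi> z] using j by simp
    also have "\<dots> = 0" by (simp add: mod_0_imp_dvd)
    finally have "(\<xi> ^^ j) (?t (- int j) (\<phi> z)) = ?t (int j) (?t (- int j) (\<phi> z))"
      using j(2) by (intro shift tp \<phi>z) linarith
    also have "\<dots> = \<phi> z" using tt [OF \<phi>z, of "int j" "- int j"] \<phi>z by (simp add: translate_zero_one)
    finally show ?thesis unfolding k(2) funpow_add comp_apply 2 .
  qed
  \<comment> \<open>Both halves follow from the root property: since \<open>n \<ge> 1\<close>,
    injectivity and surjectivity of the \<open>n\<close>-th iterate \<open>\<phi>\<close> pass to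
    \<open>\<xi>\<close>.\<close>
  have bij: "bij_betw \<xi> (points G) (points G)"
  proof (rule bij_betw_imageI)
    have \<phi>b: "bij_betw \<phi> (points G) (points G)" using monomials_Bij [OF \<phi>] by (simp add: Bij_def)
    obtain m where m: "n = Suc m" using n by (cases n) auto
    show "inj_on \<xi> (points G)"
    proof (rule inj_onI)
      fix y z assume yz: "y \<in> points G" "z \<in> points G" "\<xi> y = \<xi> z"
      then have "(\<xi> ^^ n) y = (\<xi> ^^ n) z" by (simp add: m funpow_swap1 del: funpow.simps(2) add: funpow_Suc_right)
      then show "y = z" using yz \<phi>b by (auto simp: root bij_betw_def dest: inj_onD)
    qed
    show "\<xi> ` points G = points G"
    proof (intro equalityI subsetI)
      fix y assume "y \<in> points G"
      then obtain z where z: "z \<in> points G" "y = \<phi> z" using \<phi>b unfolding bij_betw_def by blast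
      then have "y = \<xi> ((\<xi> ^^ m) z)" using root [OF z(1)] by (simp add: m)
      moreover have "(\<xi> ^^ m) z \<in> points G" using z \<xi>p by (intro funpow_closed) auto
      ultimately show "y \<in> \<xi> ` points G" by blast
    qed (use \<xi>p in auto)
  qed
  have "\<xi> \<in> monomials G (N * int n)"
  proof (rule monomialsI)
    show "\<xi> \<in> Bij (points G)" using bij by (simp add: Bij_def \<xi>_def)
  next
    fix k h z assume h: "h \<in> carrier G" and z: "z \<in> points G" and "N * int n dvd k"
    then obtain q where q: "k = N * (int n * q)" unfolding dvd_def mult.assoc by blast
    \<comment> \<open>Translating by a multiple of \<open>N * int n\<close> moves by whole large
      blocks, so both sides fall into the same case of the definition of
      \<open>\<xi>\<close>.\<close>
    have "fst (translate G k h z) div N = fst z div N + int n * q" using N by (simp add: q)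
    then have "?b (translate G k h z) = ?b z" by simp
    then show "\<xi> (translate G k h z) = translate G k h (\<xi> z)"
      using h z monomials_points [OF \<phi> z]
      by (simp add: \<xi>_def translate_points translate_translate monomials_translate [OF \<phi>] q add.commute)
  next
    fix z assume z: "z \<in> points G"
    \<comment> \<open>A shift that keeps the remainder in range stays in the same large block; it is
      applied to the wrap, with remainder \<open>n - 1\<close>, and to unit shifts from smaller
      remainders.\<close>
    have qr: "(a + c) div int n = a div int n" if "0 \<le> a mod int n + c" "a mod int n + c < int n" for a c
    proof -
      have "(a + c) div int n = ((a mod int n + c) + a div int n * int n) div int n"
        by (simp add: algebra_simps)
      also have "\<dots> = a div int n"
        using that n by (subst div_mult_self1) (auto simp: div_pos_pos_trivial)
      finally show ?thesis .
    qed
    have lt: "0 \<le> ?b z" "?b z < int n" using n by auto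
    have "fst (\<xi> z) div N div int n = fst z div N div int n"
    proof (cases "?b z = int n - 1")
      case True
      then have "\<xi> z = ?t (1 - int n) (\<phi> z)" using z by (simp add: \<xi>_def)
      then have "fst (\<xi> z) div N = fst z div N + (1 - int n)"
        by (simp only: div_t monomials_div [OF \<phi> z])
      then show ?thesis using True n qr [of "fst z div N" "1 - int n"] by simp
    next
      case False
      then have "\<xi> z = ?t 1 z" using z by (simp add: \<xi>_def)
      then have "fst (\<xi> z) div N = fst z div N + 1" by (simp only: div_t)
      then show ?thesis using False lt qr [of "fst z div N" 1] by simp
    qed
    then show "fst (\<xi> z) div (N * int n) = fst z div (N * int n)"
      using N by (simp add: zdiv_zmult2_eq)
  qed
  then show ?thesis using root by blast
qed

lemma divisible_monomial_limit: "divisible_group (monomial_limit G)"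
  unfolding divisible_group_def
proof (intro conjI ballI allI impI group_monomial_limit)
  interpret L: group "monomial_limit G" by (rule group_monomial_limit)
  fix \<phi> n assume \<phi>: "\<phi> \<in> carrier (monomial_limit G)" and n: "(n::nat) \<ge> 1"
  then obtain N where N: "N \<ge> 1" "\<phi> \<in> monomials G N" by (auto simp: carrier_monomial_limit)
  from monomials_root [OF N n] obtain \<xi> where \<xi>: "\<xi> \<in> monomials G (N * int n)"
    and root: "\<And>z. z \<in> points G \<Longrightarrow> (\<xi> ^^ n) z = \<phi> z" by blast
  have "N * int n \<ge> 1" using mult_mono [of 1 N 1 "int n"] N n by simp
  then have \<xi>c: "\<xi> \<in> carrier (monomial_limit G)" using \<xi> by (auto simp: carrier_monomial_limit)
  then have "\<xi> [^]\<^bsub>monomial_limit G\<^esub> n = \<phi>"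
    using \<phi> root by (intro monomial_limit_ext) (auto simp: monomial_limit_pow)
  then show "\<exists>x\<in>carrier (monomial_limit G). x [^]\<^bsub>monomial_limit G\<^esub> n = \<phi>" using \<xi>c by blast
qed

end

section \<open>Transport to the original type\<close>

text \<open>Transport of structure along an injection, seen as a weak morphism with trivial
  kernel.\<close>

lemma iso_image_group:
  assumes "group G" and inj: "inj_on f (carrier G)"
  shows "group (image_group f G)" "f \<in> iso G (image_group f G)"
proof -
  interpret G: group G by fact
  have "weak_group_morphism f {\<one>\<^bsub>G\<^esub>} G"
  proof (rule weak_group_morphismsI)
    show "{\<one>\<^bsub>G\<^esub>} \<lhd> G" by (rule G.one_is_normal)
    show "f a = f b \<longleftrightarrow> a \<otimes>\<^bsub>G\<^esub> inv\<^bsub>G\<^esub> b \<in> {\<one>\<^bsub>G\<^esub>}" if "a \<in> carrier G" "b \<in> carrier G" for a b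
      using that inj by (auto simp: inj_on_eq_iff G.inv_solve_right')
  qed
  then show "group (image_group f G)" "f \<in> iso G (image_group f G)"
    using G.image_group_is_group G.weak_group_morphism_is_hom inj
    by (auto simp: iso_def bij_betw_def image_group_carrier)
qed

lemma
  assumes H: "group H" and f: "f \<in> iso G H"
  shows periodic_group_iso: "periodic_group G \<Longrightarrow> periodic_group H"
    and divisible_group_iso: "divisible_group G \<Longrightarrow> divisible_group H"
proof -
  have surj: "carrier H = f ` carrier G" using f by (auto simp: iso_def bij_betw_def)
  have pow: "f x [^]\<^bsub>H\<^esub> (n::nat) = f (x [^]\<^bsub>G\<^esub> n)" if "group G" "x \<in> carrier G" for x n
  proof -
    interpret group_hom G H f
      using that H f by (intro group_hom.intro group_hom_axioms.intro) (auto simp: iso_def)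
    show ?thesis using that by (simp add: hom_nat_pow)
  qed
  have one: "f \<one>\<^bsub>G\<^esub> = \<one>\<^bsub>H\<^esub>" if "group G"
    using f H that by (auto simp: iso_def intro: hom_one)
  show "periodic_group H" if "periodic_group G"
    using that H pow one unfolding periodic_group_def surj by fastforce
  show "divisible_group H" if "divisible_group G"
    using that H pow unfolding divisible_group_def surj by (metis imageE imageI)
qed

theorem proposition1p7:
  assumes "\<exists>G :: 'a monoid. group G \<and> periodic_group G \<and> \<not> sofic G \<and> (\<nexists>g. involution G g)"
  shows "\<exists>D :: 'a monoid. group D \<and> divisible_group D \<and> periodic_group D \<and> \<not> sofic D"
proof -
  obtain G :: "'a monoid" where G: "group G" "periodic_group G" "\<not> sofic G" using assms by blast
  interpret group G by fact
  let ?L = "monomial_limit G"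
  \<comment> \<open>Non-soficity forces an infinite type, which leaves room to code the finite lists
    describing the limit within \<open>'a\<close>.\<close>
  have "infinite (carrier G)" using G sofic_if_finite by blast
  then have inf: "infinite (UNIV :: 'a set)" using infinite_super [OF subset_UNIV] by blast
  obtain c :: "(int \<times> 'a \<Rightarrow> int \<times> 'a) \<Rightarrow> (int \<times> 'a) list" where c: "inj_on c (carrier ?L)"
    using monomial_limit_lists by blast
  obtain d :: "(int \<times> 'a) list \<Rightarrow> 'a" where d: "inj d"
    using ex_inj_int_Times_list_infinite [OF inf] by blast
  have inj: "inj_on (d \<circ> c) (carrier ?L)"
    using c d by (simp add: comp_inj_on inj_on_subset)
  let ?D = "image_group (d \<circ> c) ?L"
  note D = iso_image_group [OF group_monomial_limit inj]
  have hom: "d \<circ> c \<in> hom ?L ?D" using D(2) by (simp add: iso_def)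
  let ?e = "\<lambda>g. \<lambda>z\<in>points G. (fst z, g \<otimes>\<^bsub>G\<^esub> snd z)"
  \<comment> \<open>The diagonal copy of \<open>G\<close> survives the recoding, so
    \<open>?D\<close> contains a non-sofic group.\<close>
  have "(d \<circ> c) \<circ> ?e \<in> hom G ?D" using embed_hom hom by (rule Group.hom_compose)
  moreover have "inj_on ((d \<circ> c) \<circ> ?e) (carrier G)"
    using embed_inj inj hom_carrier [OF embed_hom] by (meson comp_inj_on inj_on_subset)
  ultimately have "\<not> sofic ?D" using G sofic_if_embeds_in_sofic by blast
  moreover have "divisible_group ?D" "periodic_group ?D"
    using D divisible_monomial_limit periodic_monomial_limit [OF G(2)]
    by (auto intro: divisible_group_iso periodic_group_iso)
  ultimately show ?thesis using D(1) by blast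
qed

end
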